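(* Let $u_h\in V_{\mathcal P}$ be the unique solution of $$a(u_h^+,v_h)+s(u_h^-,v_h)=\langle f,v_h\rangle_\Omega\qquad\forall\, v_h\in V_{\mathcal P}.$$ Then $u_h^+$ satisfies the following variational inequality: $u_h^+\in V_{\mathcal P}^+$ and $$a(u_h^+,v_h-u_h^+)\ge\langle f,v_h-u_h^+\rangle_\Omega\qquad\forall\, v_h\in V_{\mathcal P}^+ .$$
   Context: Setting. $\Omega\subset\mathbb R^d$, $d\in\{1,2,3\}$, is an open bounded domain with polyhedral Lipschitz boundary; $f\in H^{-1}(\Omega)$, and $\langle\cdot,\cdot\rangle_\Omega$ is the duality pairing of $H^{-1}(\Omega)$ and $H^1_0(\Omega)$ (extending the $L^2$ inner product $(\cdot,\cdot)_\Omega$). The diffusion tensor $\mathcal D\in L^\infty(\Omega)^{d\times d}$ is symmetric and there is $d_0>0$ with $y^T\mathcal D(x)y\ge d_0|y|^2$ for all $y\in\mathbb R^d$ and a.e. $x\in\Omega$. The reaction coefficient $\mu\in L^\infty(\Omega)$ satisfies $\mu\ge\mu_0\ge0$ a.e. Set $a(v,w)=(\mathcal D\nabla v,\nabla w)_\Omega+(\mu v,w)_\Omega$. Finite elements. $\mathcal P$ is a conforming, shape-regular partition of $\Omega$ into simplices (or affine quadrilaterals/hexahedra) $K$ with diameters $h_K$; $k\ge1$; $V_{\mathcal P}$ is the space of functions in $C^0(\Omega)\cap H^1_0(\Omega)$ whose restriction to each $K$ is in $\mathbb P_k(K)$ (simplices) or $\mathbb Q_k(K)$ (affinely mapped polynomials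 of degree $\le k$ in each variable, for quadrilaterals/hexahedra). $x_1,\dots,x_N$ are the internal Lagrange nodes and $\phi_1,\dots,\phi_N$ the associated Lagrange basis of $V_{\mathcal P}$. For a node $x$, $K_x$ is the set of elements containing $x$ (also identified with their union). The mesh function $\mathfrak h$ is the continuous, element-wise linear (degree $k=1$) function whose value at each vertex $x$ of $\mathcal P$ is $\frac{1}{\#K_x}\sum_{K\in K_x}h_K$. $\omega_i$ is the union of all $K\in\mathcal P$ with $K\cap K_{x_i}\ne\emptyset$. Constrained and complementary parts. $\mathfrak a>0$ is a given constant, $V_{\mathcal P}^+=\{v_h\in V_{\mathcal P}: v_h(x_i)\in[0,\mathfrak a],\ i=1,\dots,N\}$. For $v_h\in V_{\mathcal P}$, $v_h^+=\sum_{i=1}^N\max\{0,\min\{v_h(x_i),\mathfrak a\}\}\phi_i$ and $v_h^-=v_h-v_h^+$. Stabilisation. For a constant $\alpha>0$, $$s(v,w)=\alpha\sum_{i=1}^N\big(\|\mathcal D\|_{0,\infty,\omega_i}\mathfrak h(x_i)^{d-2}+\|\mu\|_{0,\infty,\omega_i}\mathfrak h(x_i)^d\big)v(x_i)w(x_i),$$ where $\|\cdot\|_{0,\infty,\omega_i}$ is the $L^\infty(\omega_i)$-norm (with a fixed matrix norm for $\mathcal D$). *)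

theory Defs
  imports "HOL-Analysis.Analysis" "HOL-Probability.Essential_Supremum"
begin

section \<open>Domains\<close>

text \<open>Around each boundary point, in suitable orthonormal coordinates whose last axis is \<open>e\<close>, the set
  lies strictly below the graph of a Lipschitz function \<open>\<gamma>\<close>. The argument of \<open>\<gamma>\<close> is the orthogonal
  projection of \<open>y\<close> to the hyperplane orthogonal to \<open>e\<close>; in dimension one \<open>\<gamma>\<close> is a constant.\<close>

definition lipschitz_boundary :: "(real^'n) set \<Rightarrow> bool" where
  "lipschitz_boundary \<Omega> \<longleftrightarrow>
     (\<forall>p\<in>frontier \<Omega>. \<exists>U e \<gamma> L. open U \<and> p \<in> U \<and> norm e = 1 \<and> L-lipschitz_on UNIV \<gamma> \<and>
        \<Omega> \<inter> U = {y\<in>U. y \<bullet> e < (\<gamma> (y - (y \<bullet> e) *\<^sub>R e) :: real)})"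

definition polyhedral_boundary :: "(real^'n) set \<Rightarrow> bool" where
  "polyhedral_boundary \<Omega> \<longleftrightarrow>
     (\<exists>\<F>. finite \<F> \<and> (\<forall>F\<in>\<F>. polytope F \<and> aff_dim F = int CARD('n) - 1) \<and> frontier \<Omega> = \<Union>\<F>)"

definition polyhedral_lipschitz_domain :: "(real^'n) set \<Rightarrow> bool" where
  "polyhedral_lipschitz_domain \<Omega> \<longleftrightarrow>
     open \<Omega> \<and> connected \<Omega> \<and> bounded \<Omega> \<and> \<Omega> \<noteq> {} \<and> lipschitz_boundary \<Omega> \<and> polyhedral_boundary \<Omega>"


section \<open>Function spaces\<close>

text \<open>Elements of the function spaces are represented by total functions; only their values on \<open>\<Omega>\<close>
  (on the closure of \<open>\<Omega>\<close> for finite element functions) matter.\<close>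

definition partial_deriv :: "'n \<Rightarrow> (real^'n \<Rightarrow> real) \<Rightarrow> real^'n \<Rightarrow> real" where
  "partial_deriv i f x = frechet_derivative f (at x) (axis i 1)"

definition grad :: "(real^'n \<Rightarrow> real) \<Rightarrow> real^'n \<Rightarrow> real^'n" where
  "grad f x = (\<chi> i. partial_deriv i f x)"

text \<open>All iterated partial derivatives exist and are differentiable, hence continuous.\<close>

definition smooth :: "(real^'n \<Rightarrow> real) \<Rightarrow> bool" where
  "smooth f \<longleftrightarrow> (\<forall>is. foldr partial_deriv is f differentiable_on UNIV)"

definition test_functions :: "(real^'n) set \<Rightarrow> (real^'n \<Rightarrow> real) set" where
  "test_functions \<Omega> =
     {\<psi>. smooth \<psi> \<and> compact (closure {x. \<psi> x \<noteq> 0}) \<and> closure {x. \<psi> x \<noteq> 0} \<subseteq> \<Omega>}"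

definition L2 :: "(real^'n) set \<Rightarrow> (real^'n \<Rightarrow> 'b::euclidean_space) set" where
  "L2 \<Omega> = {g. g \<in> borel_measurable (lebesgue_on \<Omega>) \<and>
              integrable (lebesgue_on \<Omega>) (\<lambda>x. (norm (g x))\<^sup>2)}"

definition L2_dist :: "(real^'n) set \<Rightarrow> (real^'n \<Rightarrow> 'b::euclidean_space) \<Rightarrow> (real^'n \<Rightarrow> 'b) \<Rightarrow> real" where
  "L2_dist \<Omega> g h = sqrt (LINT x|lebesgue_on \<Omega>. (norm (g x - h x))\<^sup>2)"

definition Linf_norm :: "(real^'n) set \<Rightarrow> (real^'n \<Rightarrow> real) \<Rightarrow> real" where
  "Linf_norm S g = real_of_ereal (esssup (lebesgue_on S) (\<lambda>x. ereal \<bar>g x\<bar>))"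

definition Linf :: "(real^'n) set \<Rightarrow> (real^'n \<Rightarrow> real) set" where
  "Linf S = {g. g \<in> borel_measurable (lebesgue_on S) \<and>
                esssup (lebesgue_on S) (\<lambda>x. ereal \<bar>g x\<bar>) < \<infinity>}"

definition has_weak_gradient :: "(real^'n) set \<Rightarrow> (real^'n \<Rightarrow> real) \<Rightarrow> (real^'n \<Rightarrow> real^'n) \<Rightarrow> bool" where
  "has_weak_gradient \<Omega> v g \<longleftrightarrow>
     (\<forall>\<psi>\<in>test_functions \<Omega>. \<forall>i.
        (LINT x|lebesgue_on \<Omega>. v x * partial_deriv i \<psi> x) = - (LINT x|lebesgue_on \<Omega>. g x $ i * \<psi> x))"

definition H1 :: "(real^'n) set \<Rightarrow> (real^'n \<Rightarrow> real) set" where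
  "H1 \<Omega> = {v \<in> L2 \<Omega>. \<exists>g\<in>L2 \<Omega>. has_weak_gradient \<Omega> v g}"

text \<open>The weak gradient is unique up to null sets, so integrals of it do not depend on the choice.\<close>

definition weak_grad :: "(real^'n) set \<Rightarrow> (real^'n \<Rightarrow> real) \<Rightarrow> real^'n \<Rightarrow> real^'n" where
  "weak_grad \<Omega> v = (SOME g. g \<in> L2 \<Omega> \<and> has_weak_gradient \<Omega> v g)"

definition H1_norm :: "(real^'n) set \<Rightarrow> (real^'n \<Rightarrow> real) \<Rightarrow> real" where
  "H1_norm \<Omega> v = sqrt ((LINT x|lebesgue_on \<Omega>. (v x)\<^sup>2) +
                       (LINT x|lebesgue_on \<Omega>. (norm (weak_grad \<Omega> v x))\<^sup>2))"

text \<open>\<open>H\<^sup>1\<^sub>0(\<Omega>)\<close> is the closure of the test functions in \<open>H\<^sup>1(\<Omega>)\<close>.\<close>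

definition H10 :: "(real^'n) set \<Rightarrow> (real^'n \<Rightarrow> real) set" where
  "H10 \<Omega> = {v \<in> L2 \<Omega>. \<exists>g\<in>L2 \<Omega>. has_weak_gradient \<Omega> v g \<and>
      (\<exists>\<psi>::nat \<Rightarrow> real^'n \<Rightarrow> real. (\<forall>n. \<psi> n \<in> test_functions \<Omega>) \<and>
         (\<lambda>n. L2_dist \<Omega> (\<psi> n) v) \<longlonglongrightarrow> 0 \<and> (\<lambda>n. L2_dist \<Omega> (grad (\<psi> n)) g) \<longlonglongrightarrow> 0)}"

text \<open>The dual of \<open>H\<^sup>1\<^sub>0(\<Omega>)\<close>; the duality pairing of \<open>f\<close> and \<open>v\<close> is the application \<open>f v\<close>, and a
  square integrable \<open>g\<close> is identified with the functional \<open>v \<mapsto> (g, v)\<^sub>\<Omega>\<close>. Boundedness and linearity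
  make \<open>f\<close> insensitive to changes of its argument on null sets.\<close>

definition Hminus1 :: "(real^'n) set \<Rightarrow> ((real^'n \<Rightarrow> real) \<Rightarrow> real) set" where
  "Hminus1 \<Omega> = {f.
     (\<forall>v\<in>H10 \<Omega>. \<forall>w\<in>H10 \<Omega>. f (\<lambda>x. v x + w x) = f v + f w) \<and>
     (\<forall>c. \<forall>v\<in>H10 \<Omega>. f (\<lambda>x. c * v x) = c * f v) \<and>
     (\<exists>C. \<forall>v\<in>H10 \<Omega>. \<bar>f v\<bar> \<le> C * H1_norm \<Omega> v)}"


section \<open>Meshes and finite element spaces\<close>

text \<open>Elements are closed sets. Multi-indices are functions from the finite type \<open>'n\<close> to the
  naturals, so the index sets of the two sums below are finite.\<close>

definition poly_P :: "nat \<Rightarrow> (real^'n \<Rightarrow> real) set" where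
  "poly_P k = {p. \<exists>c. p = (\<lambda>x. \<Sum>m | (\<Sum>i\<in>UNIV. m i) \<le> k. c m * (\<Prod>i\<in>UNIV. x $ i ^ m i))}"

definition poly_Q :: "nat \<Rightarrow> (real^'n \<Rightarrow> real) set" where
  "poly_Q k = {p. \<exists>c. p = (\<lambda>x. \<Sum>m | \<forall>i. m i \<le> k. c m * (\<Prod>i\<in>UNIV. x $ i ^ m i))}"

definition simplex_cell :: "(real^'n) set \<Rightarrow> bool" where
  "simplex_cell K \<longleftrightarrow> int CARD('n) simplex K"

text \<open>The affine map \<open>x \<mapsto> b + A x\<close> maps the unit cube bijectively onto \<open>K\<close>.\<close>

definition cube_param :: "(real^'n) set \<Rightarrow> real^'n \<Rightarrow> real^'n^'n \<Rightarrow> bool" where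
  "cube_param K b A \<longleftrightarrow> invertible A \<and> K = (\<lambda>x. b + A *v x) ` cbox 0 1"

definition cube_cell :: "(real^'n) set \<Rightarrow> bool" where
  "cube_cell K \<longleftrightarrow> (\<exists>b A. cube_param K b A)"

definition cell_vertices :: "(real^'n) set \<Rightarrow> (real^'n) set" where
  "cell_vertices K = {x. x extreme_point_of K}"

definition inner_diameter :: "(real^'n) set \<Rightarrow> real" where
  "inner_diameter K = Sup {2 * r | r. 0 \<le> r \<and> (\<exists>c. cball c r \<subseteq> K)}"

definition conforming_partition :: "(real^'n) set \<Rightarrow> (real^'n) set set \<Rightarrow> bool" where
  "conforming_partition \<Omega> \<P> \<longleftrightarrow>
     finite \<P> \<and> \<Union>\<P> = closure \<Omega> \<and>
     ((\<forall>K\<in>\<P>. simplex_cell K) \<or> (\<forall>K\<in>\<P>. cube_cell K)) \<and>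
     (\<forall>K\<in>\<P>. \<forall>K'\<in>\<P>. K \<noteq> K' \<longrightarrow>
        interior K \<inter> interior K' = {} \<and> (K \<inter> K') face_of K \<and> (K \<inter> K') face_of K')"

definition shape_regular :: "real \<Rightarrow> (real^'n) set set \<Rightarrow> bool" where
  "shape_regular \<sigma> \<P> \<longleftrightarrow> (\<forall>K\<in>\<P>. diameter K \<le> \<sigma> * inner_diameter K)"

text \<open>\<open>P\<^sub>k(K)\<close> for simplices, \<open>Q\<^sub>k(K)\<close> for affine images of the cube. A set is of both kinds only in
  dimension one, where the two spaces coincide. Two parametrisations of the same \<open>K\<close> differ by a symmetry
  of the cube, so neither \<open>Q\<^sub>k(K)\<close> nor the lattice of nodes of \<open>K\<close> depends on the parametrisation.\<close>

definition local_space :: "nat \<Rightarrow> (real^'n) set \<Rightarrow> (real^'n \<Rightarrow> real) set" where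
  "local_space k K =
     (if simplex_cell K then {v. \<exists>p\<in>poly_P k. \<forall>x\<in>K. v x = p x}
      else {v. cube_cell K \<and>
               (\<forall>b A. cube_param K b A \<longrightarrow> (\<exists>p\<in>poly_Q k. \<forall>x\<in>cbox 0 1. v (b + A *v x) = p x))})"

text \<open>The equispaced nodes: barycentric coordinates, respectively reference coordinates, in
  \<open>{0, 1/k, \<dots>, 1}\<close>.\<close>

definition lagrange_nodes :: "nat \<Rightarrow> (real^'n) set \<Rightarrow> (real^'n) set" where
  "lagrange_nodes k K =
     (if simplex_cell K
      then {y. \<exists>m. (\<Sum>z\<in>cell_vertices K. m z) = k \<and>
                   y = (\<Sum>z\<in>cell_vertices K. (real (m z) / real k) *\<^sub>R z)}
      else {y. \<exists>b A m. cube_param K b A \<and> (\<forall>i. m i \<le> k) \<and>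
                       y = b + A *v (\<chi> i. real (m i) / real k)})"

definition fe_space :: "(real^'n) set \<Rightarrow> (real^'n) set set \<Rightarrow> nat \<Rightarrow> (real^'n \<Rightarrow> real) set" where
  "fe_space \<Omega> \<P> k = {v. continuous_on \<Omega> v \<and> v \<in> H10 \<Omega> \<and> (\<forall>K\<in>\<P>. v \<in> local_space k K)}"

definition internal_nodes :: "(real^'n) set \<Rightarrow> (real^'n) set set \<Rightarrow> nat \<Rightarrow> (real^'n) set" where
  "internal_nodes \<Omega> \<P> k = (\<Union>K\<in>\<P>. lagrange_nodes k K) \<inter> \<Omega>"

text \<open>Linear independence of the \<open>\<phi> i\<close> is a consequence of the second condition.\<close>

definition lagrange_basis ::
  "(real^'n) set \<Rightarrow> (real^'n) set set \<Rightarrow> nat \<Rightarrow> nat \<Rightarrow> (nat \<Rightarrow> real^'n) \<Rightarrow> (nat \<Rightarrow> real^'n \<Rightarrow> real) \<Rightarrow> bool" where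
  "lagrange_basis \<Omega> \<P> k N xs \<phi> \<longleftrightarrow>
     (\<forall>i\<in>{1..N}. \<phi> i \<in> fe_space \<Omega> \<P> k) \<and>
     (\<forall>i\<in>{1..N}. \<forall>j\<in>{1..N}. \<phi> i (xs j) = (if i = j then 1 else 0)) \<and>
     (\<forall>v\<in>fe_space \<Omega> \<P> k. \<exists>c. \<forall>y\<in>closure \<Omega>. v y = (\<Sum>i=1..N. c i * \<phi> i y))"

definition cells_at :: "(real^'n) set set \<Rightarrow> real^'n \<Rightarrow> (real^'n) set set" where
  "cells_at \<P> x = {K\<in>\<P>. x \<in> K}"

definition node_patch :: "(real^'n) set set \<Rightarrow> real^'n \<Rightarrow> (real^'n) set" where
  "node_patch \<P> x = \<Union>{K\<in>\<P>. K \<inter> \<Union>(cells_at \<P> x) \<noteq> {}}"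

text \<open>These conditions determine \<open>\<hh>\<close> on the closure of \<open>\<Omega>\<close>.\<close>

definition mesh_function :: "(real^'n) set \<Rightarrow> (real^'n) set set \<Rightarrow> (real^'n \<Rightarrow> real) \<Rightarrow> bool" where
  "mesh_function \<Omega> \<P> \<hh> \<longleftrightarrow>
     continuous_on (closure \<Omega>) \<hh> \<and> (\<forall>K\<in>\<P>. \<hh> \<in> local_space 1 K) \<and>
     (\<forall>x\<in>(\<Union>K\<in>\<P>. cell_vertices K).
        \<hh> x = (\<Sum>K\<in>cells_at \<P> x. diameter K) / real (card (cells_at \<P> x)))"

definition fe_space_plus ::
  "(real^'n) set \<Rightarrow> (real^'n) set set \<Rightarrow> nat \<Rightarrow> nat \<Rightarrow> (nat \<Rightarrow> real^'n) \<Rightarrow> real \<Rightarrow> (real^'n \<Rightarrow> real) set" where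
  "fe_space_plus \<Omega> \<P> k N xs \<aa> = {v \<in> fe_space \<Omega> \<P> k. \<forall>i\<in>{1..N}. v (xs i) \<in> {0..\<aa>}}"

definition plus_part ::
  "nat \<Rightarrow> (nat \<Rightarrow> real^'n) \<Rightarrow> (nat \<Rightarrow> real^'n \<Rightarrow> real) \<Rightarrow> real \<Rightarrow> (real^'n \<Rightarrow> real) \<Rightarrow> real^'n \<Rightarrow> real" where
  "plus_part N xs \<phi> \<aa> v = (\<lambda>y. \<Sum>i=1..N. max 0 (min (v (xs i)) \<aa>) * \<phi> i y)"

definition minus_part ::
  "nat \<Rightarrow> (nat \<Rightarrow> real^'n) \<Rightarrow> (nat \<Rightarrow> real^'n \<Rightarrow> real) \<Rightarrow> real \<Rightarrow> (real^'n \<Rightarrow> real) \<Rightarrow> real^'n \<Rightarrow> real" where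
  "minus_part N xs \<phi> \<aa> v = (\<lambda>y. v y - plus_part N xs \<phi> \<aa> v y)"


section \<open>Forms\<close>

definition matrix_norm :: "(real^'n^'n \<Rightarrow> real) \<Rightarrow> bool" where
  "matrix_norm \<nu> \<longleftrightarrow>
     (\<forall>A. \<nu> A = 0 \<longleftrightarrow> A = 0) \<and> (\<forall>c A. \<nu> (c *\<^sub>R A) = \<bar>c\<bar> * \<nu> A) \<and> (\<forall>A B. \<nu> (A + B) \<le> \<nu> A + \<nu> B)"

definition diffusion_tensor :: "(real^'n) set \<Rightarrow> real \<Rightarrow> (real^'n \<Rightarrow> real^'n^'n) \<Rightarrow> bool" where
  "diffusion_tensor \<Omega> d\<^sub>0 D \<longleftrightarrow>
     (\<forall>i j. (\<lambda>x. D x $ i $ j) \<in> Linf \<Omega>) \<and>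
     (AE x in lebesgue_on \<Omega>. transpose (D x) = D x) \<and>
     (AE x in lebesgue_on \<Omega>. \<forall>y. y \<bullet> (D x *v y) \<ge> d\<^sub>0 * (norm y)\<^sup>2)"

definition reaction_coefficient :: "(real^'n) set \<Rightarrow> real \<Rightarrow> (real^'n \<Rightarrow> real) \<Rightarrow> bool" where
  "reaction_coefficient \<Omega> \<mu>\<^sub>0 \<mu> \<longleftrightarrow> \<mu> \<in> Linf \<Omega> \<and> (AE x in lebesgue_on \<Omega>. \<mu> x \<ge> \<mu>\<^sub>0)"

definition bilinear_a ::
  "(real^'n) set \<Rightarrow> (real^'n \<Rightarrow> real^'n^'n) \<Rightarrow> (real^'n \<Rightarrow> real) \<Rightarrow>
   (real^'n \<Rightarrow> real) \<Rightarrow> (real^'n \<Rightarrow> real) \<Rightarrow> real" where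
  "bilinear_a \<Omega> D \<mu> v w =
     (LINT x|lebesgue_on \<Omega>. (D x *v weak_grad \<Omega> v x) \<bullet> weak_grad \<Omega> w x) +
     (LINT x|lebesgue_on \<Omega>. \<mu> x * v x * w x)"

text \<open>The exponent \<open>d - 2\<close> is an integer, negative for \<open>d = 1\<close>.\<close>

definition stabilisation ::
  "(real^'n) set set \<Rightarrow> nat \<Rightarrow> (nat \<Rightarrow> real^'n) \<Rightarrow> (real^'n \<Rightarrow> real) \<Rightarrow>
   (real^'n^'n \<Rightarrow> real) \<Rightarrow> (real^'n \<Rightarrow> real^'n^'n) \<Rightarrow> (real^'n \<Rightarrow> real) \<Rightarrow> real \<Rightarrow>
   (real^'n \<Rightarrow> real) \<Rightarrow> (real^'n \<Rightarrow> real) \<Rightarrow> real" where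
  "stabilisation \<P> N xs \<hh> \<nu> D \<mu> \<alpha> v w =
     \<alpha> * (\<Sum>i=1..N.
       (Linf_norm (node_patch \<P> (xs i)) (\<lambda>x. \<nu> (D x)) * \<hh> (xs i) powi (int CARD('n) - 2) +
        Linf_norm (node_patch \<P> (xs i)) \<mu> * \<hh> (xs i) ^ CARD('n)) * v (xs i) * w (xs i))"

end

theory Submission
  imports Defs
begin

text \<open>The complementary part \<open>u\<^sup>- = u - u\<^sup>+\<close> vanishes at a node unless \<open>u\<close> leaves \<open>[0, \<aa>]\<close> there, and then
  \<open>u\<^sup>-\<close> and \<open>v - u\<^sup>+\<close> have opposite signs for every \<open>v\<close> with nodal values in \<open>[0, \<aa>]\<close>. Since the nodal
  weights of the stabilisation are nonnegative, \<open>s(u\<^sup>-, v - u\<^sup>+) \<le> 0\<close>, and testing the discrete equation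
  with \<open>v - u\<^sup>+\<close> gives the inequality. The weights are nonnegative because an affine or multilinear
  function that is nonnegative at the vertices of a cell is nonnegative on the cell.\<close>

section \<open>Linearity of the function spaces\<close>

lemma norm_lincomb_square_le:
  fixes x y :: "'a::real_inner"
  shows "(norm (a *\<^sub>R x + b *\<^sub>R y))\<^sup>2 \<le> 2 * a\<^sup>2 * (norm x)\<^sup>2 + 2 * b\<^sup>2 * (norm y)\<^sup>2"
proof -
  have "(norm (a *\<^sub>R x + b *\<^sub>R y))\<^sup>2 \<le> (norm (a *\<^sub>R x) + norm (b *\<^sub>R y))\<^sup>2"
    by (intro power_mono norm_triangle_ineq) simp
  also have "\<dots> \<le> 2 * (norm (a *\<^sub>R x))\<^sup>2 + 2 * (norm (b *\<^sub>R y))\<^sup>2"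
    using sum_squares_bound[of "norm (a *\<^sub>R x)" "norm (b *\<^sub>R y)"] by (simp add: power2_sum)
  finally show ?thesis by (simp add: power_mult_distrib)
qed

text \<open>The bound by doubled squares stands in for Minkowski's inequality: it is enough as an
  integrable majorant here, and again for convergence in
  \<open>L2_dist_lincomb_tendsto\<close>.\<close>

lemma L2_lincomb:
  assumes "g \<in> L2 \<Omega>" "h \<in> L2 \<Omega>"
  shows "(\<lambda>x. a *\<^sub>R g x + b *\<^sub>R h x) \<in> L2 \<Omega>"
proof -
  have [measurable]: "g \<in> borel_measurable (lebesgue_on \<Omega>)" "h \<in> borel_measurable (lebesgue_on \<Omega>)"
    using assms by (auto simp: L2_def)
  have bnd: "(norm (a *\<^sub>R g x + b *\<^sub>R h x))\<^sup>2 \<le> 2 * a\<^sup>2 * (norm (g x))\<^sup>2 + 2 * b\<^sup>2 * (norm (h x))\<^sup>2" for x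
    using norm_lincomb_square_le .
  have "integrable (lebesgue_on \<Omega>) (\<lambda>x. 2 * a\<^sup>2 * (norm (g x))\<^sup>2 + 2 * b\<^sup>2 * (norm (h x))\<^sup>2)"
    using assms by (auto simp: L2_def)
  then have "integrable (lebesgue_on \<Omega>) (\<lambda>x. (norm (a *\<^sub>R g x + b *\<^sub>R h x))\<^sup>2)"
    by (rule Bochner_Integration.integrable_bound) (use bnd in \<open>auto intro!: order_trans[OF bnd]\<close>)
  then show ?thesis by (simp add: L2_def)
qed

lemma L2_mult_integrable:
  fixes g h :: "real^'n \<Rightarrow> real"
  assumes "g \<in> L2 \<Omega>" "h \<in> L2 \<Omega>"
  shows "integrable (lebesgue_on \<Omega>) (\<lambda>x. g x * h x)"
proof -
  have [measurable]: "g \<in> borel_measurable (lebesgue_on \<Omega>)" "h \<in> borel_measurable (lebesgue_on \<Omega>)"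
    using assms by (auto simp: L2_def)
  have bnd: "\<bar>g x * h x\<bar> \<le> (g x)\<^sup>2 + (h x)\<^sup>2" for x
    using sum_squares_bound[of "\<bar>g x\<bar>" "\<bar>h x\<bar>"] abs_ge_zero[of "g x * h x"] unfolding abs_mult
    by (simp; argo)
  have "integrable (lebesgue_on \<Omega>) (\<lambda>x. (g x)\<^sup>2 + (h x)\<^sup>2)"
    using assms by (auto simp: L2_def)
  then show ?thesis
    by (rule Bochner_Integration.integrable_bound) (auto intro!: order_trans[OF bnd])
qed

lemma L2_component:
  fixes g :: "real^'n \<Rightarrow> real^'n"
  assumes "g \<in> L2 \<Omega>"
  shows "(\<lambda>x. g x $ i) \<in> L2 \<Omega>"
proof -
  have [measurable]: "g \<in> borel_measurable (lebesgue_on \<Omega>)"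
    using assms by (auto simp: L2_def)
  have m: "(\<lambda>x. g x $ i) \<in> borel_measurable (lebesgue_on \<Omega>)"
    by (simp add: cart_eq_inner_axis)
  have bnd: "(g x $ i)\<^sup>2 \<le> (norm (g x))\<^sup>2" for x
    using power_mono[OF component_le_norm_cart abs_ge_zero, of "g x" i 2] by simp
  have "integrable (lebesgue_on \<Omega>) (\<lambda>x. (g x $ i)\<^sup>2)"
    by (rule Bochner_Integration.integrable_bound[of _ "\<lambda>x. (norm (g x))\<^sup>2"])
      (use assms m bnd in \<open>auto simp: L2_def\<close>)
  then show ?thesis using m by (simp add: L2_def)
qed

text \<open>Continuity on the whole space gives a bound on the compact closure of \<Omega>, and
  \<Omega> has finite measure. This is how test functions and their derivatives enter
  \<open>L2\<close>.\<close>

lemma continuous_in_L2: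
  fixes g :: "real^'n \<Rightarrow> 'b::euclidean_space"
  assumes "continuous_on UNIV g" "open \<Omega>" "bounded \<Omega>"
  shows "g \<in> L2 \<Omega>"
proof -
  have lm: "\<Omega> \<in> lmeasurable"
    using assms lmeasurable_open by blast
  have c: "continuous_on \<Omega> g" using assms continuous_on_subset by blast
  have m: "g \<in> borel_measurable (lebesgue_on \<Omega>)"
    by (rule continuous_imp_measurable_on_sets_lebesgue[OF c]) (use lm in auto)
  have "compact (g ` closure \<Omega>)"
    by (rule compact_continuous_image[OF continuous_on_subset[OF assms(1)]]) (use assms in auto)
  then obtain B where "\<forall>y\<in>g ` closure \<Omega>. norm y \<le> B"
    using compact_imp_bounded[of "g ` closure \<Omega>"] by (auto simp: bounded_iff)
  then have B: "norm (g x) \<le> B" if "x \<in> \<Omega>" for x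
    using that closure_subset by blast
  interpret finite_measure "lebesgue_on \<Omega>"
    using lm by (rule finite_measure_lebesgue_on)
  have "integrable (lebesgue_on \<Omega>) (\<lambda>x. (norm (g x))\<^sup>2)"
    by (rule integrable_const_bound[of _ "B\<^sup>2"]) (use m B in \<open>auto intro!: power_mono\<close>)
  then show ?thesis using m by (simp add: L2_def)
qed

section \<open>Smooth functions and test functions\<close>

lemma smooth_partial_deriv_differentiable:
  "smooth f \<Longrightarrow> foldr partial_deriv is f differentiable_on UNIV"
  by (simp add: smooth_def)

lemma partial_deriv_lincomb:
  assumes "f differentiable_on UNIV" "g differentiable_on UNIV"
  shows "partial_deriv i (\<lambda>x. a * f x + b * g x) = (\<lambda>x. a * partial_deriv i f x + b * partial_deriv i g x)"
proof
  fix x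
  have d: "(f has_derivative frechet_derivative f (at x)) (at x)"
      "(g has_derivative frechet_derivative g (at x)) (at x)"
    using assms by (auto simp: differentiable_on_def frechet_derivative_works)
  have "((\<lambda>x. a * f x + b * g x) has_derivative
      (\<lambda>y. a * frechet_derivative f (at x) y + b * frechet_derivative g (at x) y)) (at x)"
    by (intro derivative_intros d)
  then show "partial_deriv i (\<lambda>x. a * f x + b * g x) x = a * partial_deriv i f x + b * partial_deriv i g x"
    by (simp add: partial_deriv_def frechet_derivative_at[symmetric])
qed

text \<open>Induction on the list of indices: smoothness of \<open>f\<close> and \<open>g\<close>
  makes every iterated derivative differentiable, which the linearity of the next
  \<open>partial_deriv\<close> requires.\<close>

lemma iterated_partial_deriv_lincomb:
  assumes "smooth f" "smooth g"
  shows "foldr partial_deriv is (\<lambda>x. a * f x + b * g x) =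
    (\<lambda>x. a * foldr partial_deriv is f x + b * foldr partial_deriv is g x)"
  by (induction "is") (auto simp: partial_deriv_lincomb smooth_partial_deriv_differentiable assms)

lemma smooth_lincomb:
  assumes "smooth f" "smooth g"
  shows "smooth (\<lambda>x. a * f x + b * g x)"
  unfolding smooth_def iterated_partial_deriv_lincomb[OF assms]
  by (intro allI differentiable_on_add differentiable_on_mult differentiable_on_const
      smooth_partial_deriv_differentiable assms)

lemma test_functions_lincomb:
  assumes "\<psi> \<in> test_functions \<Omega>" "\<eta> \<in> test_functions \<Omega>"
  shows "(\<lambda>x. a * \<psi> x + b * \<eta> x) \<in> test_functions \<Omega>"
proof -
  let ?S = "{x. a * \<psi> x + b * \<eta> x \<noteq> 0}"
  \<comment> \<open>The support of the combination is a closed subset of the union of the two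
    supports, hence compact and inside \<Omega>.\<close>
  have "closure ?S \<subseteq> closure ({x. \<psi> x \<noteq> 0} \<union> {x. \<eta> x \<noteq> 0})"
    by (rule closure_mono) auto
  then have sub: "closure ?S \<subseteq> closure {x. \<psi> x \<noteq> 0} \<union> closure {x. \<eta> x \<noteq> 0}"
    by simp
  have "compact (closure {x. \<psi> x \<noteq> 0} \<union> closure {x. \<eta> x \<noteq> 0})"
    using assms by (auto simp: test_functions_def)
  from compact_Int_closed[OF this closed_closure[of ?S]] have "compact (closure ?S)"
    unfolding inf.absorb2[OF sub] .
  moreover have "closure ?S \<subseteq> \<Omega>"
    using sub assms unfolding test_functions_def by blast
  moreover have "smooth (\<lambda>x. a * \<psi> x + b * \<eta> x)"
    using assms by (intro smooth_lincomb) (simp_all add: test_functions_def)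
  ultimately show ?thesis
    unfolding test_functions_def by blast
qed

lemma test_function_partial_deriv_continuous:
  assumes "\<psi> \<in> test_functions \<Omega>"
  shows "continuous_on UNIV (partial_deriv i \<psi>)"
  using assms smooth_partial_deriv_differentiable[of \<psi> "[i]"]
  by (auto simp: test_functions_def intro: differentiable_imp_continuous_on)

lemma test_function_continuous:
  assumes "\<psi> \<in> test_functions \<Omega>"
  shows "continuous_on UNIV \<psi>"
  using assms smooth_partial_deriv_differentiable[of \<psi> "[]"]
  by (auto simp: test_functions_def intro: differentiable_imp_continuous_on)

lemma grad_lincomb:
  assumes "\<psi> \<in> test_functions \<Omega>" "\<eta> \<in> test_functions \<Omega>"
  shows "grad (\<lambda>x. a * \<psi> x + b * \<eta> x) = (\<lambda>x. a *\<^sub>R grad \<psi> x + b *\<^sub>R grad \<eta> x)"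
proof -
  have "\<psi> differentiable_on UNIV" "\<eta> differentiable_on UNIV"
    using assms smooth_partial_deriv_differentiable[of _ "[]"] by (auto simp: test_functions_def)
  then show ?thesis
    by (auto simp: fun_eq_iff grad_def vec_eq_iff partial_deriv_lincomb)
qed

section \<open>Weak gradients and \<open>H10\<close>\<close>

text \<open>The defining identity is linear in the pair of function and gradient. Square
  integrability enters because integrals are split only over integrable summands; the products of
  \<open>L2\<close> functions are such.\<close>

lemma has_weak_gradient_lincomb:
  assumes "open \<Omega>" "bounded \<Omega>" "v \<in> L2 \<Omega>" "w \<in> L2 \<Omega>" "g \<in> L2 \<Omega>" "h \<in> L2 \<Omega>"
    and "has_weak_gradient \<Omega> v g" "has_weak_gradient \<Omega> w h"
  shows "has_weak_gradient \<Omega> (\<lambda>x. a * v x + b * w x) (\<lambda>x. a *\<^sub>R g x + b *\<^sub>R h x)"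
  unfolding has_weak_gradient_def
proof (intro ballI allI)
  fix \<psi> i assume \<psi>: "\<psi> \<in> test_functions \<Omega>"
  have L: "\<psi> \<in> L2 \<Omega>" "partial_deriv i \<psi> \<in> L2 \<Omega>"
    using \<psi> assms test_function_continuous test_function_partial_deriv_continuous
      continuous_in_L2 by blast+
  note I = L2_mult_integrable[OF assms(3) L(2)] L2_mult_integrable[OF assms(4) L(2)]
    L2_mult_integrable[OF L2_component[OF assms(5)] L(1)]
    L2_mult_integrable[OF L2_component[OF assms(6)] L(1)]
  show "(LINT x|lebesgue_on \<Omega>. (a * v x + b * w x) * partial_deriv i \<psi> x) =
    - (LINT x|lebesgue_on \<Omega>. (a *\<^sub>R g x + b *\<^sub>R h x) $ i * \<psi> x)"
    using assms(7,8) \<psi> I by (simp add: has_weak_gradient_def distrib_right mult.assoc)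
qed

text \<open>Integrating the pointwise bound on squared norms over \<Omega> squeezes the distance of
  the combinations between 0 and \<open>?B n\<close>.\<close>

lemma L2_dist_lincomb_tendsto:
  fixes g h :: "real^'n \<Rightarrow> 'b::euclidean_space"
  assumes "\<And>n. G n \<in> L2 \<Omega>" "\<And>n. H n \<in> L2 \<Omega>" "g \<in> L2 \<Omega>" "h \<in> L2 \<Omega>"
    and "(\<lambda>n. L2_dist \<Omega> (G n) g) \<longlonglongrightarrow> 0" "(\<lambda>n. L2_dist \<Omega> (H n) h) \<longlonglongrightarrow> 0"
  shows "(\<lambda>n. L2_dist \<Omega> (\<lambda>x. a *\<^sub>R G n x + b *\<^sub>R H n x) (\<lambda>x. a *\<^sub>R g x + b *\<^sub>R h x)) \<longlonglongrightarrow> 0"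
proof (rule tendsto_sandwich[OF _ _ tendsto_const])
  let ?B = "\<lambda>n. sqrt (2 * a\<^sup>2 * (L2_dist \<Omega> (G n) g)\<^sup>2 + 2 * b\<^sup>2 * (L2_dist \<Omega> (H n) h)\<^sup>2)"
  have "?B \<longlonglongrightarrow> sqrt (2 * a\<^sup>2 * 0\<^sup>2 + 2 * b\<^sup>2 * 0\<^sup>2)"
    by (intro tendsto_intros assms)
  then show "?B \<longlonglongrightarrow> 0" by simp
  have "L2_dist \<Omega> (\<lambda>x. a *\<^sub>R G n x + b *\<^sub>R H n x) (\<lambda>x. a *\<^sub>R g x + b *\<^sub>R h x) \<le> ?B n" for n
  proof -
    let ?g = "\<lambda>x. G n x - g x" and ?h = "\<lambda>x. H n x - h x"
    have "?g \<in> L2 \<Omega>" "?h \<in> L2 \<Omega>"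
      using L2_lincomb[OF assms(1)[of n] assms(3), of 1 "-1"] L2_lincomb[OF assms(2)[of n] assms(4), of 1 "-1"]
      by simp_all
    then have I: "integrable (lebesgue_on \<Omega>) (\<lambda>x. (norm (?g x))\<^sup>2)"
      "integrable (lebesgue_on \<Omega>) (\<lambda>x. (norm (?h x))\<^sup>2)"
      "integrable (lebesgue_on \<Omega>) (\<lambda>x. (norm (a *\<^sub>R ?g x + b *\<^sub>R ?h x))\<^sup>2)"
      using L2_lincomb[of ?g \<Omega> ?h a b] by (auto simp: L2_def)
    have "(LINT x|lebesgue_on \<Omega>. (norm (a *\<^sub>R ?g x + b *\<^sub>R ?h x))\<^sup>2) \<le>
        (LINT x|lebesgue_on \<Omega>. 2 * a\<^sup>2 * (norm (?g x))\<^sup>2 + 2 * b\<^sup>2 * (norm (?h x))\<^sup>2)"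
      by (intro integral_mono norm_lincomb_square_le) (use I in auto)
    also have "\<dots> = 2 * a\<^sup>2 * (L2_dist \<Omega> (G n) g)\<^sup>2 + 2 * b\<^sup>2 * (L2_dist \<Omega> (H n) h)\<^sup>2"
      using I by (simp add: L2_dist_def)
    finally show ?thesis
      unfolding L2_dist_def by (simp add: algebra_simps)
  qed
  then show "\<forall>\<^sub>F n in sequentially. L2_dist \<Omega> (\<lambda>x. a *\<^sub>R G n x + b *\<^sub>R H n x) (\<lambda>x. a *\<^sub>R g x + b *\<^sub>R h x) \<le> ?B n"
    by simp
qed (simp add: L2_dist_def)

text \<open>Approximating test functions for \<open>v\<close> and \<open>w\<close> are combined with
  the same coefficients; their gradients converge to the combined weak gradient since
  \<open>grad\<close> is linear on test functions.\<close>

lemma H10_lincomb: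
  assumes \<Omega>: "open \<Omega>" "bounded \<Omega>" and "v \<in> H10 \<Omega>" "w \<in> H10 \<Omega>"
  shows "(\<lambda>x. a * v x + b * w x) \<in> H10 \<Omega>"
proof -
  obtain g \<psi> where v: "v \<in> L2 \<Omega>" "g \<in> L2 \<Omega>" "has_weak_gradient \<Omega> v g"
    "\<And>n::nat. \<psi> n \<in> test_functions \<Omega>"
    "(\<lambda>n. L2_dist \<Omega> (\<psi> n) v) \<longlonglongrightarrow> 0" "(\<lambda>n. L2_dist \<Omega> (grad (\<psi> n)) g) \<longlonglongrightarrow> 0"
    using assms(3) unfolding H10_def by blast
  obtain h \<eta> where w: "w \<in> L2 \<Omega>" "h \<in> L2 \<Omega>" "has_weak_gradient \<Omega> w h"
    "\<And>n::nat. \<eta> n \<in> test_functions \<Omega>"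
    "(\<lambda>n. L2_dist \<Omega> (\<eta> n) w) \<longlonglongrightarrow> 0" "(\<lambda>n. L2_dist \<Omega> (grad (\<eta> n)) h) \<longlonglongrightarrow> 0"
    using assms(4) unfolding H10_def by blast
  have t: "\<xi> \<in> L2 \<Omega>" "grad \<xi> \<in> L2 \<Omega>" if "\<xi> \<in> test_functions \<Omega>" for \<xi>
    using that \<Omega> unfolding grad_def
    by (auto intro!: continuous_in_L2 test_function_continuous[OF that] continuous_on_vec_lambda
        test_function_partial_deriv_continuous[OF that])
  show ?thesis
    unfolding H10_def
  proof (intro CollectI conjI bexI exI allI)
    show "(\<lambda>x. a * v x + b * w x) \<in> L2 \<Omega>"
      using L2_lincomb[OF v(1) w(1), of a b] by simp
    show "(\<lambda>x. a *\<^sub>R g x + b *\<^sub>R h x) \<in> L2 \<Omega>"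
      using L2_lincomb[OF v(2) w(2)] .
    show "has_weak_gradient \<Omega> (\<lambda>x. a * v x + b * w x) (\<lambda>x. a *\<^sub>R g x + b *\<^sub>R h x)"
      by (intro has_weak_gradient_lincomb \<Omega> v w)
    show "(\<lambda>x. a * \<psi> n x + b * \<eta> n x) \<in> test_functions \<Omega>" for n
      by (intro test_functions_lincomb v w)
    show "(\<lambda>n. L2_dist \<Omega> (\<lambda>x. a * \<psi> n x + b * \<eta> n x) (\<lambda>x. a * v x + b * w x)) \<longlonglongrightarrow> 0"
      using L2_dist_lincomb_tendsto[of \<psi> \<Omega> \<eta> v w a b] v w t by simp
    show "(\<lambda>n. L2_dist \<Omega> (grad (\<lambda>x. a * \<psi> n x + b * \<eta> n x)) (\<lambda>x. a *\<^sub>R g x + b *\<^sub>R h x)) \<longlonglongrightarrow> 0"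
      using L2_dist_lincomb_tendsto[of "\<lambda>n. grad (\<psi> n)" \<Omega> "\<lambda>n. grad (\<eta> n)" g h a b] v w t
      by (simp add: grad_lincomb[OF v(4) w(4)])
  qed
qed

section \<open>Polynomials, local spaces and the finite element space\<close>

lemma poly_P_lincomb:
  assumes "p \<in> poly_P k" "q \<in> poly_P k"
  shows "(\<lambda>x. a * p x + b * q x) \<in> poly_P k"
proof -
  obtain c d where "p = (\<lambda>x. \<Sum>m | (\<Sum>i\<in>UNIV. m i) \<le> k. c m * (\<Prod>i\<in>UNIV. x $ i ^ m i))"
    "q = (\<lambda>x. \<Sum>m | (\<Sum>i\<in>UNIV. m i) \<le> k. d m * (\<Prod>i\<in>UNIV. x $ i ^ m i))"
    using assms by (auto simp: poly_P_def)
  then show ?thesis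
    unfolding poly_P_def
    by (intro CollectI exI[of _ "\<lambda>m. a * c m + b * d m"])
      (simp add: sum_distrib_left sum.distrib distrib_right mult.assoc)
qed

lemma poly_Q_lincomb:
  assumes "p \<in> poly_Q k" "q \<in> poly_Q k"
  shows "(\<lambda>x. a * p x + b * q x) \<in> poly_Q k"
proof -
  obtain c d where "p = (\<lambda>x. \<Sum>m | \<forall>i. m i \<le> k. c m * (\<Prod>i\<in>UNIV. x $ i ^ m i))"
    "q = (\<lambda>x. \<Sum>m | \<forall>i. m i \<le> k. d m * (\<Prod>i\<in>UNIV. x $ i ^ m i))"
    using assms by (auto simp: poly_Q_def)
  then show ?thesis
    unfolding poly_Q_def
    by (intro CollectI exI[of _ "\<lambda>m. a * c m + b * d m"])
      (simp add: sum_distrib_left sum.distrib distrib_right mult.assoc)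
qed

lemma local_space_lincomb:
  assumes "v \<in> local_space k K" "w \<in> local_space k K"
  shows "(\<lambda>x. a * v x + b * w x) \<in> local_space k K"
proof (cases "simplex_cell K")
  case True
  then obtain p q where "p \<in> poly_P k" "\<forall>x\<in>K. v x = p x" "q \<in> poly_P k" "\<forall>x\<in>K. w x = q x"
    using assms by (auto simp: local_space_def)
  then show ?thesis
    using True poly_P_lincomb[of p k q a b] by (auto simp: local_space_def intro!: bexI)
next
  case False
  \<comment> \<open>\<open>local_space\<close> quantifies over all parametrisations of a cube cell,
    so the combination is formed separately for each of them.\<close>
  have "\<exists>r\<in>poly_Q k. \<forall>x\<in>cbox 0 1. a * v (c + A *v x) + b * w (c + A *v x) = r x"
    if par: "cube_param K c A" for c A
  proof -
    obtain p q where "p \<in> poly_Q k" "\<forall>x\<in>cbox 0 1. v (c + A *v x) = p x"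
      "q \<in> poly_Q k" "\<forall>x\<in>cbox 0 1. w (c + A *v x) = q x"
      using assms par False by (auto simp: local_space_def) metis
    then show ?thesis
      using poly_Q_lincomb[of p k q a b] by (auto intro!: bexI)
  qed
  then show ?thesis
    using False assms by (auto simp: local_space_def)
qed

lemma fe_space_lincomb:
  assumes "open \<Omega>" "bounded \<Omega>" "v \<in> fe_space \<Omega> \<P> k" "w \<in> fe_space \<Omega> \<P> k"
  shows "(\<lambda>x. a * v x + b * w x) \<in> fe_space \<Omega> \<P> k"
  using assms by (auto simp: fe_space_def intro!: continuous_intros H10_lincomb local_space_lincomb)

text \<open>Membership of the zero function is a hypothesis for the sake of the empty sum; given any
  element of \<open>fe_space\<close>, \<open>fe_space_lincomb\<close> yields it with zero
  coefficients.\<close>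

lemma fe_space_sum:
  assumes \<Omega>: "open \<Omega>" "bounded \<Omega>" and "(\<lambda>x. 0) \<in> fe_space \<Omega> \<P> k"
    and "finite I" "\<And>i. i \<in> I \<Longrightarrow> v i \<in> fe_space \<Omega> \<P> k"
  shows "(\<lambda>x. \<Sum>i\<in>I. c i * v i x) \<in> fe_space \<Omega> \<P> k"
  using assms(4,5)
proof (induction I rule: finite_induct)
  case empty
  then show ?case using assms(3) by simp
next
  case (insert j I)
  then have "(\<lambda>x. c j * v j x + 1 * (\<Sum>i\<in>I. c i * v i x)) \<in> fe_space \<Omega> \<P> k"
    by (intro fe_space_lincomb \<Omega>) auto
  then show ?case using insert by simp
qed

section \<open>Positivity of the stabilisation coefficients\<close>

text \<open>If \<open>g\<close> is not measurable the essential supremum is infinity, and on a null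
  set it is minus infinity; \<open>real_of_ereal\<close> sends both to 0. Otherwise it is compared
  with that of the constant 0.\<close>

lemma Linf_norm_nonneg: "0 \<le> Linf_norm S g"
proof -
  let ?M = "lebesgue_on S" and ?g = "\<lambda>x. ereal \<bar>g x\<bar>"
  consider "?g \<notin> borel_measurable ?M" | "?g \<in> borel_measurable ?M" "emeasure ?M (space ?M) = 0"
    | "emeasure ?M (space ?M) \<noteq> 0"
    by blast
  then show ?thesis
  proof cases
    case 1
    then show ?thesis by (simp add: Linf_norm_def esssup_non_measurable top_ereal_def)
  next
    case 2
    show ?thesis
      unfolding Linf_norm_def esssup_zero_space[OF 2(2,1)] by simp
  next
    case 3
    have "esssup ?M (\<lambda>x. 0) \<le> esssup ?M ?g"
      by (rule esssup_mono) auto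
    then show ?thesis
      unfolding Linf_norm_def esssup_const[OF 3] by (rule real_of_ereal_pos)
  qed
qed

section \<open>Affine and multilinear functions on cells\<close>

text \<open>A monomial of total degree at most 1 is a single coordinate, which is linear, or the
  constant 1, which is preserved because \<open>s + t = 1\<close>.\<close>

lemma poly_P_1_affine:
  fixes x y :: "real^'n"
  assumes "p \<in> poly_P 1" "s + t = 1"
  shows "p (s *\<^sub>R x + t *\<^sub>R y) = s * p x + t * p y"
proof -
  obtain c where c: "p = (\<lambda>x. \<Sum>m | (\<Sum>i\<in>UNIV. m i) \<le> 1. c m * (\<Prod>i\<in>UNIV. x $ i ^ m i))"
    using assms by (auto simp: poly_P_def)
  have mono: "(\<Prod>i\<in>UNIV. (s *\<^sub>R x + t *\<^sub>R y) $ i ^ m i) =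
      s * (\<Prod>i\<in>UNIV. x $ i ^ m i) + t * (\<Prod>i\<in>UNIV. y $ i ^ m i)"
    if "(\<Sum>i\<in>UNIV. m i) \<le> 1" for m :: "'n \<Rightarrow> nat"
  proof (cases "(\<Sum>i\<in>UNIV. m i) = 1")
    case True
    then obtain j where "m j = 1" "\<And>i. i \<noteq> j \<Longrightarrow> m i = 0"
      using sum_eq_1_iff[of UNIV m] by auto
    then have m: "m = (\<lambda>i. if i = j then 1 else 0)" by auto
    have "(\<Prod>i\<in>UNIV. z $ i ^ m i) = z $ j" for z :: "real^'n"
      unfolding m by (simp add: if_distrib[of "power _"] cong: if_cong)
    then show ?thesis by (simp only:) simp
  next
    case False
    then have "\<And>i. m i = 0" using that by (simp add: less_Suc_eq_0_disj le_Suc_eq)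
    then show ?thesis using assms(2) by simp
  qed
  have "p (s *\<^sub>R x + t *\<^sub>R y) = (\<Sum>m | (\<Sum>i\<in>UNIV. m i) \<le> 1.
      s * (c m * (\<Prod>i\<in>UNIV. x $ i ^ m i)) + t * (c m * (\<Prod>i\<in>UNIV. y $ i ^ m i)))"
    unfolding c by (intro sum.cong refl) (simp only: mem_Collect_eq mono distrib_left mult.left_commute)
  also have "\<dots> = s * p x + t * p y"
    unfolding c by (simp only: sum.distrib sum_distrib_left)
  finally show ?thesis .
qed

text \<open>Every exponent is 0 or 1, so \<open>p\<close> is affine in coordinate \<open>j\<close>
  with the others frozen. After splitting off the factor for \<open>j\<close>, the remaining product
  is the same at all three points.\<close>

lemma poly_Q_1_affine_coord:
  fixes x :: "real^'n"
  assumes "p \<in> poly_Q 1"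
  shows "p x = (1 - x $ j) * p (\<chi> i. if i = j then 0 else x $ i) + x $ j * p (\<chi> i. if i = j then 1 else x $ i)"
proof -
  let ?u = "\<lambda>r. (\<chi> i. if i = j then r else x $ i) :: real^'n"
  let ?M = "\<lambda>m x. \<Prod>i\<in>UNIV. (x :: real^'n) $ i ^ m i"
  obtain c where c: "p = (\<lambda>x. \<Sum>m | \<forall>i. m i \<le> 1. c m * ?M m x)"
    using assms by (auto simp: poly_Q_def)
  have mono: "?M m x = (1 - x $ j) * ?M m (?u 0) + x $ j * ?M m (?u 1)"
    if "\<forall>i. m i \<le> 1" for m :: "'n \<Rightarrow> nat"
  proof -
    have u: "?M m (?u r) = r ^ m j * (\<Prod>i\<in>UNIV - {j}. x $ i ^ m i)" for r
      by (subst prod.remove[of _ j]) (auto intro!: prod.cong)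
    have x: "?M m x = x $ j ^ m j * (\<Prod>i\<in>UNIV - {j}. x $ i ^ m i)"
      by (subst prod.remove[of _ j]) auto
    have "m j = 0 \<or> m j = 1" using that[rule_format, of j] by linarith
    then show ?thesis unfolding u x by (auto simp: algebra_simps)
  qed
  have "p x = (\<Sum>m | \<forall>i. m i \<le> 1. (1 - x $ j) * (c m * ?M m (?u 0)) + x $ j * (c m * ?M m (?u 1)))"
    unfolding c by (intro sum.cong refl, subst mono) (auto simp: algebra_simps)
  also have "\<dots> = (1 - x $ j) * p (?u 0) + x $ j * p (?u 1)"
    unfolding c by (simp only: sum.distrib sum_distrib_left)
  finally show ?thesis .
qed

text \<open>A multilinear function is in general not affine, so the set where it is nonnegative need
  not be convex; interpolation in one coordinate after another replaces a convex hull
  argument.\<close>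

lemma poly_Q_1_nonneg:
  fixes x :: "real^'n"
  assumes p: "p \<in> poly_Q 1" and vert: "\<And>y. (\<And>i. y $ i \<in> {0, 1}) \<Longrightarrow> 0 \<le> p y"
    and "x \<in> cbox 0 1"
  shows "0 \<le> p x"
proof -
  \<comment> \<open>Replace the coordinates in \<open>S\<close> by 0 or 1 one at a time.\<close>
  have "0 \<le> p x" if "finite S" "\<And>i. x $ i \<in> {0..1}" "\<And>i. i \<notin> S \<Longrightarrow> x $ i \<in> {0, 1}" for S x
    using that
  proof (induction S arbitrary: x rule: finite_induct)
    case empty
    then show ?case using vert by blast
  next
    case (insert j S)
    \<comment> \<open>Fixing coordinate \<open>j\<close> at 0 or 1 leaves only those in
      \<open>S\<close> free, so the induction hypothesis applies; \<open>p x\<close> is then a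
      convex combination of the two values.\<close>
    have "0 \<le> p (\<chi> i. if i = j then r else x $ i)" if "r \<in> {0, 1}" for r
      using insert.prems that by (intro insert.IH) auto
    then show ?case
      unfolding poly_Q_1_affine_coord[OF p, of x j] using insert.prems(1)[of j] by auto
  qed
  from this[of UNIV x] show ?thesis using assms(3) by (auto simp: mem_box_cart)
qed

text \<open>A coordinate equal to an endpoint of [0,1] cannot lie strictly between two different
  values in [0,1], so 0/1 points are extreme in the unit cube; injective affine maps preserve
  extreme points.\<close>

lemma cube_vertex:
  assumes "cube_param K b A" "\<And>i. y $ i \<in> {0, 1}"
  shows "b + A *v y \<in> cell_vertices K"
proof -
  have K: "K = (\<lambda>x. b + A *v x) ` cbox 0 1" and inj: "inj ((*v) A)"
    using assms(1) by (auto simp: cube_param_def invertible_eq_bij bij_is_inj)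
  have "y extreme_point_of cbox 0 1"
    unfolding extreme_point_of_def
  proof (intro conjI ballI notI)
    show "y \<in> cbox 0 1"
      unfolding mem_box_cart using assms(2) by (auto, metis order.refl zero_le_one, metis order.refl zero_le_one)
  next
    fix u w assume uw: "u \<in> cbox 0 1" "w \<in> cbox 0 1" "y \<in> open_segment u w"
    then obtain t where t: "u \<noteq> w" "0 < t" "t < 1" "y = (1 - t) *\<^sub>R u + t *\<^sub>R w"
      by (auto simp: in_segment)
    have "u $ i = w $ i" for i
    proof -
      have b: "0 \<le> u $ i" "u $ i \<le> 1" "0 \<le> w $ i" "w $ i \<le> 1"
        using uw by (auto simp: mem_box_cart)
      have y: "y $ i = (1 - t) * u $ i + t * w $ i" using t by simp
      consider "y $ i = 0" | "y $ i = 1" using assms(2) by blast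
      then show ?thesis
      proof cases
        case 1
        then have "(1 - t) * u $ i = 0 \<and> t * w $ i = 0"
          using y b t by (simp add: add_nonneg_eq_0_iff)
        then show ?thesis using t by simp
      next
        case 2
        \<comment> \<open>Reflecting the coordinate at 1/2 reduces this to the previous case: two
          nonnegative terms add up to 0.\<close>
        then have "(1 - t) * (1 - u $ i) + t * (1 - w $ i) = 0"
          using y by (simp add: algebra_simps)
        then have "(1 - t) * (1 - u $ i) = 0 \<and> t * (1 - w $ i) = 0"
          using b t by (subst (asm) add_nonneg_eq_0_iff) auto
        then show ?thesis using t by simp
      qed
    qed
    then show False using t(1) by (simp add: vec_eq_iff)
  qed
  \<comment> \<open>An extreme point is a one-point face, so the theorem on linear images of faces
    applies.\<close>
  then have "A *v y extreme_point_of ((*v) A ` cbox 0 1)"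
    using face_of_linear_image[OF matrix_vector_mul_linear inj, of "{y}" "cbox 0 1"]
    by (simp add: face_of_singleton)
  then have "b + A *v y extreme_point_of ((+) b ` (*v) A ` cbox 0 1)"
    by (simp add: extreme_point_of_translation_eq)
  then show ?thesis by (simp add: cell_vertices_def K image_image)
qed

text \<open>On a simplex the nonnegativity set of an affine function is convex, so with the vertices
  it contains their hull. A cube cell is pulled back to the unit cube, where
  \<open>poly_Q_1_nonneg\<close> applies and \<open>cube_vertex\<close> identifies the
  corners.\<close>

lemma local_space_1_nonneg:
  assumes "v \<in> local_space 1 K" "\<And>z. z \<in> cell_vertices K \<Longrightarrow> 0 \<le> v z" "x \<in> K"
  shows "0 \<le> v x"
proof (cases "simplex_cell K")
  case True
  then obtain p where p: "p \<in> poly_P 1" "\<And>y. y \<in> K \<Longrightarrow> v y = p y"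
    using assms(1) by (auto simp: local_space_def)
  obtain C where C: "\<not> affine_dependent C" "K = convex hull C"
    using True by (auto simp: simplex_cell_def simplex)
  \<comment> \<open>Affine independence makes every point of \<open>C\<close> an extreme point of
    the hull, so the vertex hypothesis covers all of \<open>C\<close>.\<close>
  have "C \<subseteq> {y. 0 \<le> p y}"
  proof
    fix z assume "z \<in> C"
    then have "z \<in> cell_vertices K" "z \<in> K"
      using C by (auto simp: cell_vertices_def extreme_point_of_convex_hull_affine_independent hull_inc)
    then show "z \<in> {y. 0 \<le> p y}" using assms(2) p(2) by fastforce
  qed
  moreover have "convex {y. 0 \<le> p y}"
    unfolding convex_def by (auto simp: poly_P_1_affine[OF p(1)])
  ultimately have "K \<subseteq> {y. 0 \<le> p y}"
    unfolding C by (rule hull_minimal)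
  then show ?thesis using assms(3) p(2) by auto
next
  case False
  then obtain b A where par: "cube_param K b A"
    using assms(1) by (auto simp: local_space_def cube_cell_def)
  then obtain p where p: "p \<in> poly_Q 1" "\<And>y. y \<in> cbox 0 1 \<Longrightarrow> v (b + A *v y) = p y"
    using assms(1) False by (auto simp: local_space_def) metis
  obtain y where y: "y \<in> cbox 0 1" "x = b + A *v y"
    using par assms(3) by (auto simp: cube_param_def)
  have "0 \<le> p z" if z: "\<And>i. z $ i \<in> {0, 1}" for z
  proof -
    have "z \<in> cbox 0 1" 
      unfolding mem_box_cart using z by (auto, metis order.refl zero_le_one, metis order.refl zero_le_one)
    then show ?thesis using assms(2) cube_vertex[OF par z] p(2) by metis
  qed
  then show ?thesis using poly_Q_1_nonneg[OF p(1) _ y(1)] p(2)[OF y(1)] y(2) by simp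
qed

section \<open>Cell diameters and the mesh function\<close>

lemma cell_bounded:
  assumes "simplex_cell K \<or> cube_cell K"
  shows "bounded K"
proof -
  have "compact ((\<lambda>x. b + A *v x) ` cbox 0 1)" for b :: "real^'n" and A :: "real^'n^'n"
    by (intro compact_continuous_image continuous_intros compact_cbox)
  then show ?thesis
    using assms by (auto simp: simplex_cell_def cube_cell_def cube_param_def
        intro: compact_imp_bounded compact_simplex)
qed

text \<open>Vertex values are averages of diameters, and \<open>local_space_1_nonneg\<close> carries
  their sign to the whole cell. The bound is wanted at Lagrange nodes, which for
  \<open>k > 1\<close> need not be vertices.\<close>

lemma mesh_function_nonneg:
  assumes "conforming_partition \<Omega> \<P>" "mesh_function \<Omega> \<P> \<hh>" "x \<in> closure \<Omega>"
  shows "0 \<le> \<hh> x"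
proof -
  have "x \<in> \<Union>\<P>"
    using assms(1,3) by (simp add: conforming_partition_def)
  then obtain K where K: "K \<in> \<P>" "x \<in> K"
    by blast
  show ?thesis
  proof (rule local_space_1_nonneg[OF _ _ K(2)])
    show "\<hh> \<in> local_space 1 K" using assms(2) K by (auto simp: mesh_function_def)
    have "0 \<le> diameter K'" if "K' \<in> \<P>" for K'
      using assms(1) that by (intro diameter_ge_0 cell_bounded) (auto simp: conforming_partition_def)
    \<comment> \<open>This includes points \<open>z\<close> in no cell, since division by 0 gives
      0.\<close>
    then have "0 \<le> (\<Sum>K\<in>cells_at \<P> z. diameter K) / real (card (cells_at \<P> z))" for z
      by (intro divide_nonneg_nonneg sum_nonneg) (auto simp: cells_at_def)
    then show "0 \<le> \<hh> z" if "z \<in> cell_vertices K" for z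
      using assms(2) K that by (auto simp: mesh_function_def)
  qed
qed

section \<open>The variational inequality\<close>

lemma plus_part_node:
  assumes "lagrange_basis \<Omega> \<P> k N xs \<phi>" "j \<in> {1..N}"
  shows "plus_part N xs \<phi> \<aa> v (xs j) = max 0 (min (v (xs j)) \<aa>)"
proof -
  have "plus_part N xs \<phi> \<aa> v (xs j) = (\<Sum>i=1..N. if i = j then max 0 (min (v (xs i)) \<aa>) else 0)"
    unfolding plus_part_def using assms by (intro sum.cong) (auto simp: lagrange_basis_def)
  then show ?thesis using assms(2) by simp
qed

text \<open>\<open>max 0 (min t a)\<close> is the point of [0,a] nearest to \<open>t\<close>, and
  the inequality is the variational characterisation of this projection. The hypothesis makes the
  interval nonempty.\<close>

lemma truncation_residual_nonpos:
  fixes t s a :: real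
  assumes "s \<in> {0..a}"
  shows "(t - max 0 (min t a)) * (s - max 0 (min t a)) \<le> 0"
  using assms by (auto simp: max_def min_def mult_le_0_iff)

lemma stabilisation_truncation_nonpos:
  fixes D :: "real^'n \<Rightarrow> real^'n^'n"
  assumes "0 \<le> \<alpha>" and basis: "lagrange_basis \<Omega> \<P> k N xs \<phi>"
    and h: "\<And>i. i \<in> {1..N} \<Longrightarrow> 0 \<le> \<hh> (xs i)"
    and v: "v \<in> fe_space_plus \<Omega> \<P> k N xs \<aa>"
  shows "stabilisation \<P> N xs \<hh> \<nu> D \<mu> \<alpha> (minus_part N xs \<phi> \<aa> u)
    (\<lambda>y. v y - plus_part N xs \<phi> \<aa> u y) \<le> 0"
  unfolding stabilisation_def
proof (rule mult_nonneg_nonpos[OF assms(1) sum_nonpos])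
  fix i assume i: "i \<in> {1..N}"
  let ?c = "Linf_norm (node_patch \<P> (xs i)) (\<lambda>x. \<nu> (D x)) * \<hh> (xs i) powi (int CARD('n) - 2) +
    Linf_norm (node_patch \<P> (xs i)) \<mu> * \<hh> (xs i) ^ CARD('n)"
  \<comment> \<open>In dimension one the exponent of the \<open>powi\<close> term is -1; an integer
    power of a nonnegative base is still nonnegative.\<close>
  have "0 \<le> ?c"
    using h[OF i] by (intro add_nonneg_nonneg mult_nonneg_nonneg Linf_norm_nonneg) auto
  moreover have "minus_part N xs \<phi> \<aa> u (xs i) * (v (xs i) - plus_part N xs \<phi> \<aa> u (xs i)) \<le> 0"
    using v i by (auto simp: minus_part_def plus_part_node[OF basis i] fe_space_plus_def
        intro!: truncation_residual_nonpos)
  ultimately show "?c * minus_part N xs \<phi> \<aa> u (xs i) * (v (xs i) - plus_part N xs \<phi> \<aa> u (xs i)) \<le> 0"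
    unfolding mult.assoc by (rule mult_nonneg_nonpos)
qed

theorem theorem3p5:
  fixes \<Omega> :: "(real^'n) set" and f :: "(real^'n \<Rightarrow> real) \<Rightarrow> real"
    and D :: "real^'n \<Rightarrow> real^'n^'n" and \<nu> :: "real^'n^'n \<Rightarrow> real" and d\<^sub>0 :: real
    and \<mu> :: "real^'n \<Rightarrow> real" and \<mu>\<^sub>0 :: real
    and \<P> :: "(real^'n) set set" and \<sigma> :: real and k :: nat
    and N :: nat and xs :: "nat \<Rightarrow> real^'n" and \<phi> :: "nat \<Rightarrow> real^'n \<Rightarrow> real"
    and \<hh> :: "real^'n \<Rightarrow> real" and \<aa> \<alpha> :: real and u\<^sub>h :: "real^'n \<Rightarrow> real"
  assumes "CARD('n) \<in> {1, 2, 3}"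
    and "polyhedral_lipschitz_domain \<Omega>"
    and "f \<in> Hminus1 \<Omega>"
    and "d\<^sub>0 > 0" and "diffusion_tensor \<Omega> d\<^sub>0 D" and "matrix_norm \<nu>"
    and "\<mu>\<^sub>0 \<ge> 0" and "reaction_coefficient \<Omega> \<mu>\<^sub>0 \<mu>"
    and "conforming_partition \<Omega> \<P>" and "shape_regular \<sigma> \<P>" and "k \<ge> 1"
    and "bij_betw xs {1..N} (internal_nodes \<Omega> \<P> k)"
    and "lagrange_basis \<Omega> \<P> k N xs \<phi>"
    and "mesh_function \<Omega> \<P> \<hh>"
    and "\<aa> > 0" and "\<alpha> > 0"
    and "u\<^sub>h \<in> fe_space \<Omega> \<P> k"
    and "\<forall>v\<^sub>h\<in>fe_space \<Omega> \<P> k.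
           bilinear_a \<Omega> D \<mu> (plus_part N xs \<phi> \<aa> u\<^sub>h) v\<^sub>h
           + stabilisation \<P> N xs \<hh> \<nu> D \<mu> \<alpha> (minus_part N xs \<phi> \<aa> u\<^sub>h) v\<^sub>h = f v\<^sub>h"
  shows "plus_part N xs \<phi> \<aa> u\<^sub>h \<in> fe_space_plus \<Omega> \<P> k N xs \<aa> \<and>
    (\<forall>v\<^sub>h\<in>fe_space_plus \<Omega> \<P> k N xs \<aa>.
       bilinear_a \<Omega> D \<mu> (plus_part N xs \<phi> \<aa> u\<^sub>h) (\<lambda>y. v\<^sub>h y - plus_part N xs \<phi> \<aa> u\<^sub>h y)
       \<ge> f (\<lambda>y. v\<^sub>h y - plus_part N xs \<phi> \<aa> u\<^sub>h y))"
proof -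
  have \<Omega>: "open \<Omega>" "bounded \<Omega>"
    using assms(2) by (auto simp: polyhedral_lipschitz_domain_def)
  let ?u = "plus_part N xs \<phi> \<aa> u\<^sub>h"
  \<comment> \<open>The zero function is obtained as a trivial combination of
    \<open>u\<^sub>h\<close>, to start the sum that defines \<open>?u\<close>.\<close>
  have "(\<lambda>x. 0) \<in> fe_space \<Omega> \<P> k"
    using fe_space_lincomb[OF \<Omega> assms(17) assms(17), of 0 0] by simp
  then have u: "?u \<in> fe_space \<Omega> \<P> k"
    unfolding plus_part_def using assms(13)
    by (intro fe_space_sum \<Omega>) (auto simp: lagrange_basis_def)
  have "?u \<in> fe_space_plus \<Omega> \<P> k N xs \<aa>"
    using u assms(15) by (auto simp: fe_space_plus_def plus_part_node[OF assms(13)])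
  moreover have "f (\<lambda>y. v y - ?u y) \<le> bilinear_a \<Omega> D \<mu> ?u (\<lambda>y. v y - ?u y)"
    if v: "v \<in> fe_space_plus \<Omega> \<P> k N xs \<aa>" for v
  proof -
    have "0 \<le> \<hh> (xs i)" if "i \<in> {1..N}" for i
    proof -
      have "xs i \<in> \<Omega>"
        using assms(12) that by (auto simp: bij_betw_def internal_nodes_def)
      then show ?thesis
        using mesh_function_nonneg[OF assms(9,14)] closure_subset by blast
    qed
    then have "stabilisation \<P> N xs \<hh> \<nu> D \<mu> \<alpha> (minus_part N xs \<phi> \<aa> u\<^sub>h) (\<lambda>y. v y - ?u y) \<le> 0"
      using assms(16) by (intro stabilisation_truncation_nonpos[OF _ assms(13) _ v]) auto
    \<comment> \<open>The difference is itself a finite element function, so the discrete equation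
      can be tested with it; dropping the nonpositive stabilisation term leaves the
      inequality.\<close>
    moreover have "(\<lambda>y. v y - ?u y) \<in> fe_space \<Omega> \<P> k"
      using fe_space_lincomb[OF \<Omega> _ u, of v 1 "-1"] v by (simp add: fe_space_plus_def)
    ultimately show ?thesis using assms(18) by fastforce
  qed
  ultimately show ?thesis by blast
qed

end
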